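(* Let $M\in\mathfrak{M}_d(\mathbb{C})$ be a diagonalizable complex matrix all of whose eigenvalues lie on the unit circle, and let $\{D_i\}_{i\ge1}$ be a sequence in $\mathfrak{M}_d(\mathbb{C})$ with $\sum_{i\ge1}\|D_i-M\|<\infty$. Let $\varepsilon_n=\sum_{i>n}\|D_i-M\|$. Then $$F=\lim_{n\to\infty}\left(\prod_{i=1}^n D_i\right)M^{-n}$$ exists in $\mathfrak{M}_d(\mathbb{C})$, and $\det(F)\ne0$ if and only if all the elements of the sequence $\{D_i\}$ are invertible. Moreover, $\left\|F-\left(\prod_{i=1}^n D_i\right)M^{-n}\right\|=O(\varepsilon_n)$ as $n\to\infty$, and: (i) $\left\|\prod_{i=1}^n D_i-FM^n\right\|=O(\varepsilon_n)$. Thus $\copyright\left(\prod_{i=1}^n D_i\right)=\copyright(FM^n)$. (ii) Let $f$ be a continuous function from the domain $$\overline{\{FM^n:n\ge h\}}\cup\bigcup_{n\ge h}\left\{\prod_{i=1}^n D_i\right\},$$ for some integer $h\ge1$, into a metric space $G$. Then the domain of $f$ is compact and $f\left(\prod_{i=1}^n D_i\right)\asymp f(FM^n)$. Hence $\copyright\left(f\left(\prod_{i=1}^n D_i\right)\right)=\copyright(f(FM^n))$.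
   Context: $\mathfrak{M}_d(\mathbb{C})$ is the algebra of $d\times d$ complex matrices with a fixed norm $\|\cdot\|$ (all norms being equivalent). Products are taken from left to right: $\prod_{i=1}^n A_i=A_1A_2\cdots A_n$. $\overline{S}$ denotes the closure of $S$. For sequences in a metric space $(X,d)$, $s_n\asymp t_n$ means $\lim_{n\to\infty}d(s_n,t_n)=0$. The sequential closure $\copyright(s_n)$ of a sequence is the set of limits of its convergent subsequences. *)

theory Defs
  imports "HOL-Analysis.Analysis" "HOL-Library.Landau_Symbols"
begin

text \<open>
  Matrix powers and products use \<^const>\<open>matrix_matrix_mult\<close>. The class operations
  \<^const>\<open>power\<close> and \<^const>\<open>prod\<close> on the type of matrices act componentwise and are not
  what is wanted.
\<close>

primrec mat_pow :: "complex^'n^'n \<Rightarrow> nat \<Rightarrow> complex^'n^'n" where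
  "mat_pow M 0 = mat 1"
| "mat_pow M (Suc n) = mat_pow M n ** M"

text \<open>The sequence of factors starts at index 1; the value \<open>D 0\<close> is never used.\<close>

primrec left_prod :: "(nat \<Rightarrow> complex^'n^'n) \<Rightarrow> nat \<Rightarrow> complex^'n^'n" where
  "left_prod D 0 = mat 1"
| "left_prod D (Suc n) = left_prod D n ** D (Suc n)"

definition matrix_norm :: "(complex^'n^'n \<Rightarrow> real) \<Rightarrow> bool" where
  "matrix_norm N \<longleftrightarrow>
     (\<forall>A. 0 \<le> N A) \<and>
     (\<forall>A. N A = 0 \<longleftrightarrow> A = 0) \<and>
     (\<forall>c A. N (\<chi> i j. c * A $ i $ j) = cmod c * N A) \<and>
     (\<forall>A B. N (A + B) \<le> N A + N B)"

definition diagonal :: "complex^'n^'n \<Rightarrow> bool" where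
  "diagonal A \<longleftrightarrow> (\<forall>i j. i \<noteq> j \<longrightarrow> A $ i $ j = 0)"

definition diagonalizable :: "complex^'n^'n \<Rightarrow> bool" where
  "diagonalizable M \<longleftrightarrow>
     (\<exists>P :: complex^'n^'n. invertible P \<and> diagonal (matrix_inv P ** M ** P))"

definition eigenvalue :: "complex^'n^'n \<Rightarrow> complex \<Rightarrow> bool" where
  "eigenvalue M c \<longleftrightarrow> (\<exists>v. v \<noteq> 0 \<and> M *v v = c *s v)"

definition asymp_seq :: "(nat \<Rightarrow> 'a::metric_space) \<Rightarrow> (nat \<Rightarrow> 'a) \<Rightarrow> bool" where
  "asymp_seq s t \<longleftrightarrow> (\<lambda>n. dist (s n) (t n)) \<longlonglongrightarrow> 0"

definition seq_closure :: "(nat \<Rightarrow> 'a::metric_space) \<Rightarrow> 'a set" where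
  "seq_closure s = {l. \<exists>r. strict_mono r \<and> (s \<circ> r) \<longlonglongrightarrow> l}"

end

theory Submission
  imports Defs
begin

text \<open>
  Write \<open>P n = left_prod D n\<close>, \<open>V = matrix_inv M\<close> and \<open>Q n = P n ** mat_pow V n\<close>. Since \<open>M\<close> is
  conjugate to a diagonal matrix with unimodular entries, the powers of \<open>M\<close> and of \<open>V\<close> are bounded
  by a common constant \<open>K\<close> (\<open>diagonalizable_unimodular_powers_bounded\<close>). The sequence \<open>Q\<close> is
  itself a product of matrices: \<open>Q n = (mat 1 + E 1) ** \<dots> ** (mat 1 + E n)\<close> with
  \<open>E i = mat_pow M (i - 1) ** (D i - M) ** mat_pow V i\<close>
  (\<open>left_prod_mult_mat_pow_inverse\<close>), and \<open>norm (E i) \<le> K\<^sup>2 * norm (D i - M)\<close> is summable.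

  The theorem is thereby reduced to infinite products of summable perturbations of the identity. Their
  partial products are bounded by a constant times \<open>exp (\<Sum>i. norm (E i))\<close>, so consecutive ones
  differ by a multiple of \<open>norm (E i)\<close>. Hence they converge to some \<open>F\<close>, at a rate given by the tails
  of the series (\<open>left_prod_near_1_converges\<close>). As for \<open>det F\<close>, cutting the product after \<open>m\<close>
  factors gives \<open>F = Q m ** T\<close>, where \<open>T\<close> is as close to the identity as desired, and so invertible,
  once \<open>m\<close> is large. Thus \<open>F\<close> is singular only if one of the factors is
  (\<open>det_left_prod_limit_nonzero_iff\<close>). Multiplying the rate by \<open>mat_pow M n\<close>, which is bounded,
  turns \<open>F - Q n = O(\<epsilon> n)\<close> into \<open>P n - F ** mat_pow M n = O(\<epsilon> n)\<close>.

  The rest is metric topology. Sequences whose distance tends to 0 have the same sequential closure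
  (\<open>asymp_seq_imp_seq_closure_eq\<close>); adding to a compact set a sequence that is asymptotic to a
  sequence inside it leaves it compact (\<open>compact_Un_asymptotic_seq\<close>); and a continuous function on
  a compact set is uniformly continuous, hence preserves asymptotic equivalence
  (\<open>asymp_seq_continuous_image\<close>). All estimates are made in the Euclidean norm of the matrix entries,
  which is submultiplicative, and transferred to \<open>N\<close> by the equivalence of norms.
\<close>

section \<open>The Euclidean norm of complex matrices\<close>

lemma sum_cmod_mult_le_norm_mult:
  fixes x y :: "complex^'m"
  shows "cmod (\<Sum>k\<in>UNIV. x $ k * y $ k) \<le> norm x * norm y"
proof -
  have "cmod (\<Sum>k\<in>UNIV. x $ k * y $ k) \<le> (\<Sum>k\<in>UNIV. \<bar>cmod (x $ k)\<bar> * \<bar>cmod (y $ k)\<bar>)"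
    by (rule order_trans[OF norm_sum]) (simp add: norm_mult)
  also have "\<dots> \<le> norm x * norm y"
    unfolding norm_vec_def by (rule L2_set_mult_ineq)
  finally show ?thesis .
qed

lemma norm_matrix_vector_mult_le:
  fixes A :: "complex^'m^'n"
  shows "norm (A *v x) \<le> norm A * norm x"
proof -
  have "norm (A *v x) \<le> L2_set (\<lambda>i. norm (A $ i) * norm x) UNIV"
    unfolding norm_vec_def[of "A *v x"]
    by (rule L2_set_mono) (simp_all add: matrix_vector_mult_def sum_cmod_mult_le_norm_mult)
  also have "\<dots> = norm A * norm x"
    by (simp add: norm_vec_def[of A] L2_set_left_distrib)
  finally show ?thesis .
qed

lemma norm_transpose: "norm (transpose A) = norm (A :: complex^'m^'n)"
proof -
  have "(\<Sum>i\<in>UNIV. \<Sum>j\<in>UNIV. (norm (A $ j $ i))\<^sup>2) = (\<Sum>i\<in>UNIV. \<Sum>j\<in>UNIV. (norm (A $ i $ j))\<^sup>2)"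
    by (rule sum.swap)
  then show ?thesis
    by (simp add: norm_vec_def L2_set_def transpose_def sum_nonneg)
qed

lemma norm_matrix_mult_le:
  fixes A :: "complex^'m^'n" and B :: "complex^'p^'m"
  shows "norm (A ** B) \<le> norm A * norm B"
proof -
  have row: "transpose (A ** B) $ j = A *v (transpose B $ j)" for j
    by (simp add: transpose_def matrix_matrix_mult_def matrix_vector_mult_def)
  have "norm (A ** B) = norm (transpose (A ** B))"
    by (simp only: norm_transpose)
  also have "\<dots> = L2_set (\<lambda>j. norm (A *v (transpose B $ j))) UNIV"
    by (simp add: norm_vec_def[of "transpose (A ** B)"] row)
  also have "\<dots> \<le> L2_set (\<lambda>j. norm A * norm (transpose B $ j)) UNIV"
    by (rule L2_set_mono) (simp_all add: norm_matrix_vector_mult_le)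
  also have "\<dots> = norm A * norm (transpose B)"
    by (simp add: norm_vec_def[of "transpose B"] L2_set_right_distrib)
  finally show ?thesis by (simp only: norm_transpose)
qed

text \<open>
  This makes limits and distributivity over differences available for products of matrices.
\<close>
interpretation matrix_mult:
  bounded_bilinear "(**) :: complex^'m^'n \<Rightarrow> complex^'p^'m \<Rightarrow> complex^'p^'n"
proof
  show "\<exists>K. \<forall>(A::complex^'m^'n) (B::complex^'p^'m). norm (A ** B) \<le> norm A * norm B * K"
    by (rule exI[of _ 1]) (simp add: norm_matrix_mult_le)
qed (simp_all add: matrix_matrix_mult_def vec_eq_iff sum.distrib algebra_simps scaleR_sum_right)

text \<open>
  If \<open>T *v x = 0\<close>, then \<open>x\<close> and \<open>(T - mat 1) *v x = - x\<close> have the same norm; as \<open>T - mat 1\<close> is a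
  strict contraction, \<open>x = 0\<close>.
\<close>
lemma invertible_near_mat_1:
  fixes T :: "complex^'n^'n"
  assumes "norm (T - mat 1) < 1"
  shows "invertible T"
proof -
  have "x = 0" if "T *v x = 0" for x
  proof (rule ccontr)
    assume "x \<noteq> 0"
    have "(T - mat 1) *v x = - x"
      using that by (simp add: matrix_vector_mult_diff_rdistrib)
    then have "norm x \<le> norm (T - mat 1) * norm x"
      using norm_matrix_vector_mult_le[of "T - mat 1" x] by simp
    with assms \<open>x \<noteq> 0\<close> show False by simp
  qed
  then show ?thesis
    by (auto simp: invertible_left_inverse matrix_left_invertible_ker)
qed

section \<open>Infinite products of summable perturbations of the identity\<close>

lemma left_prod_add:
  "left_prod A (m + n) = left_prod A m ** left_prod (\<lambda>i. A (i + m)) n"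
  by (induction n) (simp_all add: matrix_mul_assoc add.commute)

lemma det_left_prod: "det (left_prod A n) = (\<Prod>i=1..n. det (A i))"
  by (induction n) (simp_all add: det_mul mult.commute)

text \<open>
  The factor \<open>norm (mat 1)\<close> is the square root of the dimension: the Euclidean norm is not an
  operator norm.
\<close>
lemma norm_left_prod_le:
  fixes E :: "nat \<Rightarrow> complex^'n^'n"
  shows "norm (left_prod (\<lambda>i. mat 1 + E i) n)
    \<le> norm (mat 1 :: complex^'n^'n) * exp (\<Sum>i<n. norm (E (Suc i)))"
proof (induction n)
  case (Suc n)
  let ?Q = "left_prod (\<lambda>i. mat 1 + E i) n"
  have "norm (?Q ** (mat 1 + E (Suc n))) \<le> norm ?Q * (1 + norm (E (Suc n)))"
    using norm_triangle_ineq[of ?Q "?Q ** E (Suc n)"] norm_matrix_mult_le[of ?Q "E (Suc n)"]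
    by (simp add: matrix_add_ldistrib algebra_simps)
  also have "\<dots> \<le> (norm (mat 1 :: complex^'n^'n) * exp (\<Sum>i<n. norm (E (Suc i))))
      * exp (norm (E (Suc n)))"
    by (intro mult_mono Suc.IH) (auto simp: exp_ge_add_one_self)
  finally show ?case by (simp add: exp_add mult.assoc)
qed simp

text \<open>
  All partial products are bounded by \<open>B = norm (mat 1) * exp S\<close>, and so multiplying by a further
  factor \<open>mat 1 + E (Suc i)\<close> moves them by at most \<open>B * norm (E (Suc i))\<close>. One bound \<open>S\<close> serves
  all the products obtained by dropping initial factors, which makes \<open>B\<close> uniform in the cut-off.
\<close>
lemma left_prod_near_1_converges:
  fixes E :: "nat \<Rightarrow> complex^'n^'n"
  assumes sE: "summable (\<lambda>i. norm (E (Suc i)))"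
    and le: "(\<Sum>i. norm (E (Suc i))) \<le> S"
  obtains F where "left_prod (\<lambda>i. mat 1 + E i) \<longlonglongrightarrow> F"
    and "\<And>n. norm (F - left_prod (\<lambda>i. mat 1 + E i) n)
      \<le> norm (mat 1 :: complex^'n^'n) * exp S * (\<Sum>i. norm (E (Suc (i + n))))"
proof -
  define Q where "Q = left_prod (\<lambda>i. mat 1 + E i)"
  define B where "B = norm (mat 1 :: complex^'n^'n) * exp S"
  have QB: "norm (Q n) \<le> B" for n
  proof -
    have "(\<Sum>i<n. norm (E (Suc i))) \<le> S"
      using sum_le_suminf[OF sE, of "{..<n}"] le by simp
    then show ?thesis
      unfolding Q_def B_def
      by (intro order_trans[OF norm_left_prod_le] mult_left_mono) auto
  qed
  have step: "norm (Q (Suc i) - Q i) \<le> B * norm (E (Suc i))" for i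
  proof -
    have "Q (Suc i) - Q i = Q i ** E (Suc i)"
      by (simp add: Q_def matrix_add_ldistrib)
    then show ?thesis
      using norm_matrix_mult_le[of "Q i" "E (Suc i)"] mult_right_mono[OF QB[of i] norm_ge_zero[of "E (Suc i)"]]
      by simp
  qed
  have sQ: "summable (\<lambda>i. norm (Q (Suc i) - Q i))"
    by (rule summable_comparison_test'[OF summable_mult[OF sE, of B]]) (use step in auto)
  then have "summable (\<lambda>i. Q (Suc i) - Q i)"
    by (rule summable_norm_cancel)
  then have "convergent Q"
    by (simp add: summable_iff_convergent sum_lessThan_telescope convergent_diff_const_right_iff)
  then obtain F where F: "Q \<longlonglongrightarrow> F" by (auto simp: convergent_def)
  have "norm (F - Q n) \<le> B * (\<Sum>i. norm (E (Suc (i + n))))" for n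
  proof -
    have "(\<lambda>i. Q (Suc i + n) - Q (i + n)) sums (F - Q (0 + n))"
      by (rule telescope_sums) (rule LIMSEQ_ignore_initial_segment[OF F])
    then have "F - Q n = (\<Sum>i. Q (Suc (i + n)) - Q (i + n))"
      by (simp add: sums_iff)
    also have "norm \<dots> \<le> (\<Sum>i. norm (Q (Suc (i + n)) - Q (i + n)))"
      by (rule summable_norm) (use summable_ignore_initial_segment[OF sQ, of n] in simp)
    also have "\<dots> \<le> (\<Sum>i. B * norm (E (Suc (i + n))))"
      using summable_ignore_initial_segment[OF sQ, of n]
        summable_mult[OF summable_ignore_initial_segment[OF sE, of n], of B]
      by (intro suminf_le step) simp_all
    also have "\<dots> = B * (\<Sum>i. norm (E (Suc (i + n))))"
      using summable_ignore_initial_segment[OF sE, of n] by (intro suminf_mult) simp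
    finally show ?thesis .
  qed
  with F show ?thesis by (intro that[of F]) (simp_all add: Q_def B_def)
qed

text \<open>
  A limit of invertible matrices may be singular, so this needs more than continuity of the
  determinant. The idea is to factor \<open>F = Q m ** T\<close>, where \<open>T\<close> is the product of all factors after the
  \<open>m\<close>-th one. If the \<open>m\<close>-th factor is singular, so are \<open>Q m\<close> and \<open>F\<close>. Conversely, the distance of \<open>T\<close>
  to the identity is at most a constant times a tail of a convergent series, so \<open>T\<close> is invertible
  for large \<open>m\<close>.
\<close>
lemma det_left_prod_limit_nonzero_iff:
  fixes E :: "nat \<Rightarrow> complex^'n^'n"
  assumes sE: "summable (\<lambda>i. norm (E (Suc i)))"
    and F: "left_prod (\<lambda>i. mat 1 + E i) \<longlonglongrightarrow> F"
  shows "det F \<noteq> 0 \<longleftrightarrow> (\<forall>i\<ge>1. det (mat 1 + E i) \<noteq> 0)"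
proof -
  define S where "S = (\<Sum>i. norm (E (Suc i)))"
  define Q where "Q = left_prod (\<lambda>i. mat 1 + E i)"
  define B where "B = norm (mat 1 :: complex^'n^'n) * exp S"
  have split: "\<exists>T. F = Q m ** T \<and> norm (T - mat 1) \<le> B * (\<Sum>i. norm (E (Suc (i + m))))" for m
  proof -
    have s: "summable (\<lambda>i. norm (E (Suc i + m)))"
      using summable_ignore_initial_segment[OF sE, of m] by simp
    have "(\<Sum>i. norm (E (Suc i + m))) \<le> S"
      using suminf_split_initial_segment[OF sE, of m] by (simp add: S_def sum_nonneg)
    then obtain T where T: "left_prod (\<lambda>i. mat 1 + E (i + m)) \<longlonglongrightarrow> T"
      "\<And>n. norm (T - left_prod (\<lambda>i. mat 1 + E (i + m)) n) \<le> B * (\<Sum>i. norm (E (Suc (i + n) + m)))"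
      unfolding B_def
      using left_prod_near_1_converges[of "\<lambda>i. E (i + m)", OF s] by blast
    have "(\<lambda>n. Q m ** left_prod (\<lambda>i. mat 1 + E (i + m)) n) \<longlonglongrightarrow> Q m ** T"
      by (intro matrix_mult.tendsto tendsto_const T)
    moreover have "(\<lambda>n. Q m ** left_prod (\<lambda>i. mat 1 + E (i + m)) n) = (\<lambda>n. Q (n + m))"
      by (simp only: Q_def left_prod_add[of "\<lambda>i. mat 1 + E i" m, symmetric] add.commute[of m])
    ultimately have "F = Q m ** T"
      using LIMSEQ_unique LIMSEQ_ignore_initial_segment[OF F, of m] by (simp add: Q_def)
    \<comment> \<open>The empty product is the identity, so the rate of convergence at 0 bounds \<open>T - mat 1\<close>.\<close>
    with T(2)[of 0] show ?thesis by auto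
  qed
  show ?thesis
  proof
    assume "det F \<noteq> 0"
    show "\<forall>i\<ge>1. det (mat 1 + E i) \<noteq> 0"
    proof (intro allI impI)
      fix i :: nat assume "1 \<le> i"
      obtain T where "F = Q i ** T" using split by blast
      with \<open>det F \<noteq> 0\<close> have "det (Q i) \<noteq> 0" by (auto simp: det_mul)
      with \<open>1 \<le> i\<close> show "det (mat 1 + E i) \<noteq> 0" by (simp add: Q_def det_left_prod)
    qed
  next
    assume R: "\<forall>i\<ge>1. det (mat 1 + E i) \<noteq> 0"
    have "(\<lambda>m. B * (\<Sum>i. norm (E (Suc (i + m))))) \<longlonglongrightarrow> B * 0"
      by (intro tendsto_mult tendsto_const suminf_exist_split2[OF sE])
    then have "eventually (\<lambda>m. B * (\<Sum>i. norm (E (Suc (i + m)))) < 1) sequentially"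
      by (rule order_tendstoD) simp
    then obtain m where "B * (\<Sum>i. norm (E (Suc (i + m)))) < 1"
      by (auto simp: eventually_sequentially)
    moreover obtain T where "F = Q m ** T" "norm (T - mat 1) \<le> B * (\<Sum>i. norm (E (Suc (i + m))))"
      using split by blast
    ultimately have "F = Q m ** T" "invertible T"
      using invertible_near_mat_1[of T] by auto
    then show "det F \<noteq> 0"
      using R by (auto simp: Q_def det_mul det_left_prod invertible_det_nz)
  qed
qed

section \<open>Asymptotic sequences\<close>

lemma asymp_seqE:
  assumes "asymp_seq s t" "e > 0"
  obtains n0 where "\<And>n. n \<ge> n0 \<Longrightarrow> dist (s n) (t n) < e"
proof -
  have "eventually (\<lambda>n. dist (s n) (t n) < e) sequentially"
    using assms unfolding asymp_seq_def by (intro order_tendstoD(2))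
  then show ?thesis unfolding eventually_sequentially using that by blast
qed

lemma asymp_seq_sym: "asymp_seq s t \<Longrightarrow> asymp_seq t s"
  by (simp add: asymp_seq_def dist_commute)

lemma asymp_seq_imp_seq_closure_eq:
  assumes "asymp_seq s t"
  shows "seq_closure s = seq_closure t"
proof -
  have "seq_closure s \<subseteq> seq_closure t" if "asymp_seq s t" for s t :: "nat \<Rightarrow> 'a"
  proof
    fix l assume "l \<in> seq_closure s"
    then obtain r where r: "strict_mono r" "(s \<circ> r) \<longlonglongrightarrow> l" by (auto simp: seq_closure_def)
    have "((\<lambda>n. dist (s n) (t n)) \<circ> r) \<longlonglongrightarrow> 0"
      using that r(1) unfolding asymp_seq_def by (rule LIMSEQ_subseq_LIMSEQ)
    moreover have "(\<lambda>n. dist ((s \<circ> r) n) l) \<longlonglongrightarrow> 0"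
      using r(2) by (rule tendsto_dist_iff[THEN iffD1])
    ultimately have "(\<lambda>n. dist (s (r n)) (t (r n)) + dist (s (r n)) l) \<longlonglongrightarrow> 0"
      using tendsto_add[of "(\<lambda>n. dist (s n) (t n)) \<circ> r" 0 sequentially "\<lambda>n. dist ((s \<circ> r) n) l" 0]
      by (simp add: o_def)
    then have "(\<lambda>n. dist ((t \<circ> r) n) l) \<longlonglongrightarrow> 0"
    proof (rule Lim_null_comparison[rotated], intro always_eventually allI)
      show "norm (dist ((t \<circ> r) n) l) \<le> dist (s (r n)) (t (r n)) + dist (s (r n)) l" for n
        using dist_triangle3[of "(t \<circ> r) n" l "(s \<circ> r) n"] by simp
    qed
    then have "(t \<circ> r) \<longlonglongrightarrow> l"
      by (rule tendsto_dist_iff[THEN iffD2])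
    with r(1) show "l \<in> seq_closure t" by (auto simp: seq_closure_def)
  qed
  from this[OF assms] this[OF asymp_seq_sym[OF assms]] show ?thesis by blast
qed

text \<open>
  A finite part of an open cover that covers \<open>K\<close> also covers a neighbourhood of \<open>K\<close> of positive
  radius, and hence all but finitely many of the points \<open>s n\<close>.
\<close>
lemma compact_Un_asymptotic_seq:
  fixes s t :: "nat \<Rightarrow> 'a::metric_space"
  assumes K: "compact K" and t: "\<And>n. n \<ge> h \<Longrightarrow> t n \<in> K" and a: "asymp_seq s t"
  shows "compact (K \<union> (\<Union>n\<in>{h..}. {s n}))"
proof (rule compactI)
  fix C assume C: "\<forall>U\<in>C. open U" "K \<union> (\<Union>n\<in>{h..}. {s n}) \<subseteq> \<Union>C"
  have op: "\<And>U. U \<in> C \<Longrightarrow> open U" using C(1) by blast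
  have sC: "s n \<in> \<Union>C" if "n \<ge> h" for n
    by (rule subsetD[OF C(2)]) (use that in auto)
  have "K \<subseteq> \<Union>C" using C(2) by (rule order_trans[OF Un_upper1])
  from compactE[OF K this op] obtain C1 where C1: "C1 \<subseteq> C" "finite C1" "K \<subseteq> \<Union>C1"
    by metis
  have "open (\<Union>C1)" using op C1(1) by (intro open_Union) blast
  from compact_subset_open_imp_ball_epsilon_subset[OF K this C1(3)]
  obtain e where e: "e > 0" "(\<Union>x\<in>K. ball x e) \<subseteq> \<Union>C1"
    by metis
  from asymp_seqE[OF a e(1)] obtain n0 where n0: "\<And>n. n \<ge> n0 \<Longrightarrow> dist (s n) (t n) < e"
    by metis
  have "compact (s ` {h..<n0})" by (intro finite_imp_compact finite_imageI) simp
  moreover have "s ` {h..<n0} \<subseteq> \<Union>C" using sC by (intro image_subsetI) simp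
  ultimately obtain C2 where C2: "C2 \<subseteq> C" "finite C2" "s ` {h..<n0} \<subseteq> \<Union>C2"
    using compactE[OF _ _ op] by metis
  have "s n \<in> \<Union>(C1 \<union> C2)" if "n \<ge> h" for n
  proof (cases "n < n0")
    case True
    then have "s n \<in> s ` {h..<n0}" using that by simp
    with C2(3) show ?thesis by blast
  next
    case False
    then have "s n \<in> (\<Union>x\<in>K. ball x e)"
      using n0[of n] t[OF that] by (intro UN_I[of "t n"]) (simp_all add: dist_commute)
    then have "s n \<in> \<Union>C1" using e(2) by (rule subsetD[rotated])
    then show ?thesis by simp
  qed
  then have "K \<union> (\<Union>n\<in>{h..}. {s n}) \<subseteq> \<Union>(C1 \<union> C2)"
    using C1(3) by (intro Un_least UN_least) auto
  with C1 C2 show "\<exists>C'\<subseteq>C. finite C' \<and> K \<union> (\<Union>n\<in>{h..}. {s n}) \<subseteq> \<Union>C'"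
    by (intro exI[of _ "C1 \<union> C2"] conjI Un_least) simp_all
qed

lemma asymp_seq_continuous_image:
  fixes f :: "'a::metric_space \<Rightarrow> 'b::metric_space"
  assumes "compact X" "continuous_on X f"
    and X: "\<And>n. n \<ge> h \<Longrightarrow> s n \<in> X" "\<And>n. n \<ge> h \<Longrightarrow> t n \<in> X"
    and a: "asymp_seq s t"
  shows "asymp_seq (\<lambda>n. f (s n)) (\<lambda>n. f (t n))"
  unfolding asymp_seq_def
proof (rule LIMSEQ_I)
  fix r :: real assume "r > 0"
  have "uniformly_continuous_on X f"
    using compact_uniformly_continuous assms(1,2) by blast
  with \<open>r > 0\<close> obtain d where d: "d > 0" "\<And>x y. x \<in> X \<Longrightarrow> y \<in> X \<Longrightarrow> dist x y < d \<Longrightarrow> dist (f x) (f y) < r"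
    unfolding uniformly_continuous_on_def by metis
  from asymp_seqE[OF a d(1)] obtain n0 where "\<And>n. n \<ge> n0 \<Longrightarrow> dist (s n) (t n) < d"
    by metis
  then have "norm (dist (f (s n)) (f (t n)) - 0) < r" if "n \<ge> max h n0" for n
    using d(2)[OF X, of n n] that by simp
  then show "\<exists>no. \<forall>n\<ge>no. norm (dist (f (s n)) (f (t n)) - 0) < r"
    by blast
qed

section \<open>Equivalence of norms\<close>

text \<open>
  The upper bound comes from expanding in the basis. It makes \<open>N\<close> Lipschitz, so that \<open>N\<close> attains
  a positive minimum on the compact unit sphere; this gives the lower bound.
\<close>

lemma norm_equivalence:
  fixes N :: "'a::euclidean_space \<Rightarrow> real"
  assumes nonneg: "\<And>x. 0 \<le> N x" and zero: "\<And>x. N x = 0 \<Longrightarrow> x = 0"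
    and scale: "\<And>r x. N (r *\<^sub>R x) = \<bar>r\<bar> * N x"
    and tri: "\<And>x y. N (x + y) \<le> N x + N y"
  obtains C c where "C > 0" "c > 0" "\<And>x. N x \<le> C * norm x" "\<And>x. norm x \<le> c * N x"
proof -
  define C where "C = 1 + (\<Sum>b\<in>Basis. N b)"
  have N0: "N 0 = 0" using scale[of 0 0] by simp
  have Nsum: "N (\<Sum>b\<in>A. g b) \<le> (\<Sum>b\<in>A. N (g b))" if "finite A" for A and g :: "'a \<Rightarrow> 'a"
    using that by (induction A) (auto simp: N0 intro: order_trans[OF tri])
  have "C > 0" unfolding C_def by (intro add_pos_nonneg sum_nonneg nonneg) simp
  have up: "N x \<le> C * norm x" for x
  proof -
    have "N x = N (\<Sum>b\<in>Basis. (x \<bullet> b) *\<^sub>R b)" by (simp add: euclidean_representation)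
    also have "\<dots> \<le> (\<Sum>b\<in>Basis. \<bar>x \<bullet> b\<bar> * N b)"
      using Nsum[of Basis "\<lambda>b. (x \<bullet> b) *\<^sub>R b"] by (simp add: scale)
    also have "\<dots> \<le> (\<Sum>b\<in>Basis. norm x * N b)"
      by (intro sum_mono mult_right_mono nonneg Basis_le_norm)
    also have "\<dots> \<le> C * norm x"
      by (simp add: C_def sum_distrib_left algebra_simps)
    finally show ?thesis .
  qed
  have minus: "N (x - y) = N (y - x)" for x y
    using scale[of "-1" "x - y"] by simp
  have lip: "\<bar>N x - N y\<bar> \<le> C * norm (x - y)" for x y
    using tri[of "x - y" y] tri[of "y - x" x] minus[of x y] up[of "x - y"] by simp
  have "C-lipschitz_on UNIV N"
    using lip \<open>C > 0\<close> by (intro lipschitz_onI) (auto simp: dist_norm)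
  then have cont: "continuous_on (sphere 0 1) N"
    by (intro continuous_on_subset[OF lipschitz_on_continuous_on]) auto
  have "sphere (0::'a) 1 \<noteq> {}"
    by (simp add: sphere_eq_empty)
  from continuous_attains_inf[OF compact_sphere this cont] obtain x0
    where x0: "x0 \<in> sphere 0 1" "\<And>x. x \<in> sphere 0 1 \<Longrightarrow> N x0 \<le> N x" by auto
  have "N x0 > 0"
    using x0(1) zero[of x0] nonneg[of x0] by fastforce
  have low: "norm x \<le> inverse (N x0) * N x" for x
  proof (cases "x = 0")
    case False
    then have "N x0 \<le> N ((1 / norm x) *\<^sub>R x)" by (intro x0(2)) simp
    then have "N x0 \<le> N x / norm x" by (simp add: scale)
    with False \<open>N x0 > 0\<close> show ?thesis by (simp add: field_simps)
  qed (simp add: N0)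
  show ?thesis
    using that[of C "inverse (N x0)"] \<open>C > 0\<close> \<open>N x0 > 0\<close> up low by simp
qed


section \<open>Powers of a diagonalizable matrix with unimodular spectrum\<close>

definition diag_matrix :: "('n \<Rightarrow> complex) \<Rightarrow> complex^'n^'n" where
  "diag_matrix d = (\<chi> i j. if i = j then d i else 0)"

lemma diag_matrix_mult_component: "(diag_matrix d ** A) $ i $ j = d i * A $ i $ j"
  by (simp add: diag_matrix_def matrix_matrix_mult_def mult_delta_left)

lemma diag_matrix_mult: "diag_matrix a ** diag_matrix b = diag_matrix (\<lambda>i. a i * b i)"
  by (simp add: vec_eq_iff diag_matrix_mult_component) (simp add: diag_matrix_def)

lemma mat_1_eq_diag_matrix: "mat 1 = diag_matrix (\<lambda>_. 1)"
  by (simp add: diag_matrix_def mat_def)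

lemma mat_pow_diag_matrix: "mat_pow (diag_matrix d) n = diag_matrix (\<lambda>i. d i ^ n)"
  by (induction n) (simp_all add: mat_1_eq_diag_matrix diag_matrix_mult mult.commute)

lemma norm_diag_matrix_le:
  assumes "\<And>i. cmod (d i) \<le> 1"
  shows "norm (diag_matrix d :: complex^'n^'n) \<le> norm (mat 1 :: complex^'n^'n)"
  unfolding norm_vec_def by (intro L2_set_mono) (simp_all add: diag_matrix_def mat_def assms)

lemma diag_matrix_mult_axis: "diag_matrix d *v axis i 1 = d i *s axis i 1"
  by (simp add: diag_matrix_def axis_def matrix_vector_mult_def vec_eq_iff mult_delta_left)

lemma mat_pow_conjugate:
  assumes "P ** P' = mat 1" "P' ** P = mat 1"
  shows "mat_pow (P ** A ** P') n = P ** mat_pow A n ** P'"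
proof (induction n)
  case (Suc n)
  have "mat_pow (P ** A ** P') (Suc n) = P ** mat_pow A n ** (P' ** P) ** A ** P'"
    by (simp add: Suc.IH matrix_mul_assoc)
  then show ?case by (simp add: assms matrix_mul_assoc)
qed (simp add: assms)

lemma mat_pow_Suc_left: "mat_pow A (Suc n) = A ** mat_pow A n"
proof (induction n)
  case (Suc n)
  have "mat_pow A (Suc (Suc n)) = mat_pow A (Suc n) ** A" by simp
  also have "\<dots> = A ** mat_pow A n ** A" by (simp only: Suc.IH)
  also have "\<dots> = A ** mat_pow A (Suc n)" by (simp add: matrix_mul_assoc)
  finally show ?case .
qed simp

lemma mat_pow_mult_inverse:
  assumes "A ** B = mat 1"
  shows "mat_pow A n ** mat_pow B n = mat 1"
proof (induction n)
  case (Suc n)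
  have "mat_pow A (Suc n) ** mat_pow B (Suc n) = mat_pow A n ** (A ** B) ** mat_pow B n"
    by (simp add: mat_pow_Suc_left[of B] matrix_mul_assoc del: mat_pow.simps(2))
       (simp add: matrix_mul_assoc)
  then show ?case by (simp add: assms Suc.IH)
qed simp

lemma matrix_inv_mult:
  assumes "invertible A"
  shows "A ** matrix_inv A = mat 1" "matrix_inv A ** A = mat 1"
  using someI_ex[OF assms[unfolded invertible_def]] by (simp_all add: matrix_inv_def)

lemma matrix_inv_eqI:
  fixes A B :: "complex^'n^'n"
  assumes "A ** B = mat 1"
  shows "matrix_inv A = B"
proof -
  have "invertible A" using assms by (auto simp: invertible_right_inverse)
  then have "matrix_inv A ** (A ** B) = B"
    by (simp add: matrix_mul_assoc matrix_inv_mult)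
  then show ?thesis by (simp add: assms)
qed

text \<open>
  If \<open>M = P ** diag_matrix d ** P'\<close> with \<open>P'\<close> the inverse of \<open>P\<close>, then the \<open>d i\<close> are eigenvalues, so
  they lie on the unit circle and so do their powers. The powers of \<open>M\<close> are therefore bounded by
  \<open>norm P * norm (mat 1) * norm P'\<close>, and the same holds for the inverse of \<open>M\<close>, which is
  \<open>P ** diag_matrix (\<lambda>i. inverse (d i)) ** P'\<close>.
\<close>
lemma diagonalizable_unimodular_powers_bounded:
  fixes M :: "complex^'n^'n"
  assumes "diagonalizable M" and unim: "\<forall>c. eigenvalue M c \<longrightarrow> cmod c = 1"
  obtains K where "K > 0" "M ** matrix_inv M = mat 1"
    "\<And>n. norm (mat_pow M n) \<le> K" "\<And>n. norm (mat_pow (matrix_inv M) n) \<le> K"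
proof -
  obtain P :: "complex^'n^'n" where P: "invertible P" "diagonal (matrix_inv P ** M ** P)"
    using assms(1) by (auto simp: diagonalizable_def)
  define P' where "P' = matrix_inv P"
  have PP': "P ** P' = mat 1" "P' ** P = mat 1"
    using matrix_inv_mult[OF P(1)] by (simp_all add: P'_def)
  define d where "d i = (P' ** M ** P) $ i $ i" for i
  have "P' ** M ** P = diag_matrix d"
    using P(2) by (auto simp: diagonal_def diag_matrix_def vec_eq_iff d_def P'_def)
  then have "P ** diag_matrix d ** P' = P ** (P' ** M ** P) ** P'" by simp
  also have "\<dots> = (P ** P') ** M ** (P ** P')" by (simp only: matrix_mul_assoc)
  finally have M: "M = P ** diag_matrix d ** P'" by (simp add: PP')
  have d1: "cmod (d i) = 1" for i
  proof -
    let ?v = "P *v axis i 1"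
    have v: "P' *v ?v = axis i 1" by (simp add: matrix_vector_mul_assoc PP')
    have "?v \<noteq> 0"
    proof
      assume "?v = 0"
      with v have "axis i (1::complex) = 0" by simp
      then show False by simp
    qed
    moreover have "M *v ?v = P *v (diag_matrix d *v (P' *v ?v))"
      by (simp add: M matrix_vector_mul_assoc matrix_mul_assoc)
    then have "M *v ?v = d i *s ?v"
      by (simp add: v diag_matrix_mult_axis vector_scalar_commute)
    ultimately have "eigenvalue M (d i)" by (auto simp: eigenvalue_def)
    with unim show ?thesis by blast
  qed
  have d0: "d i \<noteq> 0" for i using d1[of i] by auto
  define e where "e i = inverse (d i)" for i
  have e1: "cmod (e i) = 1" for i by (simp add: e_def norm_inverse d1)
  have "M ** (P ** diag_matrix e ** P') = P ** diag_matrix d ** (P' ** P) ** diag_matrix e ** P'"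
    by (simp add: M matrix_mul_assoc)
  also have "\<dots> = P ** (diag_matrix d ** diag_matrix e) ** P'"
    by (simp add: PP' matrix_mul_assoc)
  also have "\<dots> = mat 1"
    by (simp add: diag_matrix_mult e_def d0 mat_1_eq_diag_matrix[symmetric] PP')
  finally have MR: "M ** (P ** diag_matrix e ** P') = mat 1" .
  then have V: "matrix_inv M = P ** diag_matrix e ** P'" by (rule matrix_inv_eqI)
  \<comment> \<open>The summand 1 makes \<open>K\<close> visibly positive.\<close>
  define K where "K = norm P * norm (mat 1 :: complex^'n^'n) * norm P' + 1"
  have bound: "norm (mat_pow (P ** diag_matrix a ** P') n) \<le> K" if "\<And>i. cmod (a i) = 1" for a n
  proof -
    have "norm (P ** diag_matrix (\<lambda>i. a i ^ n) ** P')
        \<le> norm P * norm (diag_matrix (\<lambda>i. a i ^ n)) * norm P'"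
      by (intro order_trans[OF norm_matrix_mult_le] mult_right_mono norm_matrix_mult_le norm_ge_zero)
    also have "\<dots> \<le> norm P * norm (mat 1 :: complex^'n^'n) * norm P'"
      by (intro mult_right_mono mult_left_mono norm_diag_matrix_le norm_ge_zero)
         (simp add: norm_power that)
    finally show ?thesis
      by (simp add: mat_pow_conjugate PP' mat_pow_diag_matrix K_def)
  qed
  have "K > 0" by (simp add: K_def add_nonneg_pos)
  then show ?thesis
    using that[of K] MR bound[of d, OF d1] bound[of e, OF e1] V by (simp add: M[symmetric])
qed

section \<open>Reduction to perturbations of the identity\<close>

lemma infsum_greaterThan_eq_suminf:
  fixes g :: "nat \<Rightarrow> real"
  assumes "\<And>i. 0 \<le> g i" and "g summable_on {1..}"
  shows "summable (\<lambda>i. g (Suc i))" and "infsum g {n<..} = (\<Sum>i. g (Suc (i + n)))"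
proof -
  have img: "{n<..} = (\<lambda>i. Suc (i + n)) ` UNIV" for n
    by (auto simp: image_iff) (metis add.commute less_iff_Suc_add)
  have inj: "inj (\<lambda>i. Suc (i + n))" for n by (auto simp: inj_def)
  have "g summable_on {0<..}" using assms(2) by (simp add: atLeast_Suc_greaterThan)
  then have "(g \<circ> (\<lambda>i. Suc (i + 0))) summable_on UNIV"
    using summable_on_reindex[OF inj[of 0], of g] img[of 0] by simp
  then show s: "summable (\<lambda>i. g (Suc i))"
    by (intro summable_on_imp_summable) (simp add: o_def)
  have "summable (\<lambda>i. g (Suc (i + n)))"
    using summable_ignore_initial_segment[OF s, of n] by simp
  then have "((\<lambda>i. g (Suc (i + n))) has_sum (\<Sum>i. g (Suc (i + n)))) UNIV"
    by (intro sums_nonneg_imp_has_sum summable_sums) (simp_all add: assms(1))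
  then have "infsum (g \<circ> (\<lambda>i. Suc (i + n))) UNIV = (\<Sum>i. g (Suc (i + n)))"
    unfolding o_def by (rule infsumI)
  then show "infsum g {n<..} = (\<Sum>i. g (Suc (i + n)))"
    using infsum_reindex[OF inj[of n], of g] img[of n] by simp
qed

text \<open>
  Passing from \<open>n\<close> to \<open>n + 1\<close> in \<open>left_prod D n ** mat_pow V n\<close> multiplies it on the right by
  \<open>mat_pow M n ** D (Suc n) ** mat_pow V (Suc n)\<close>, which is the identity when \<open>D (Suc n) = M\<close>.
\<close>
lemma conjugated_factor_eq:
  fixes M V :: "complex^'n^'n"
  assumes "M ** V = mat 1"
  shows "mat 1 + mat_pow M n ** (A - M) ** mat_pow V (Suc n) = mat_pow M n ** A ** mat_pow V (Suc n)"
proof -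
  have "mat_pow M n ** M ** mat_pow V (Suc n) = mat 1"
    using mat_pow_mult_inverse[OF assms, of "Suc n"] by simp
  then show ?thesis
    by (simp only: matrix_mult.diff_left matrix_mult.diff_right) simp
qed

lemma left_prod_mult_mat_pow_inverse:
  fixes M V :: "complex^'n^'n"
  assumes "M ** V = mat 1"
  shows "left_prod D n ** mat_pow V n
    = left_prod (\<lambda>i. mat 1 + mat_pow M (i - 1) ** (D i - M) ** mat_pow V i) n" (is "_ = left_prod ?A n")
proof (induction n)
  case (Suc n)
  have VM: "V ** M = mat 1" using assms by (simp add: matrix_left_right_inverse)
  have "left_prod ?A (Suc n) = left_prod D n ** mat_pow V n ** (mat_pow M n ** D (Suc n) ** mat_pow V (Suc n))"
    using conjugated_factor_eq[OF assms, of n "D (Suc n)"] by (simp add: Suc.IH del: mat_pow.simps)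
  also have "\<dots> = left_prod D n ** (mat_pow V n ** mat_pow M n) ** D (Suc n) ** mat_pow V (Suc n)"
    by (simp only: matrix_mul_assoc)
  finally show ?case
    by (simp only: mat_pow_mult_inverse[OF VM] matrix_mul_rid left_prod.simps matrix_mul_assoc)
qed simp

section \<open>Products that approach the powers of a fixed matrix\<close>

theorem theorem4:
  fixes M :: "complex^'n^'n"
    and D :: "nat \<Rightarrow> complex^'n^'n"
    and N :: "complex^'n^'n \<Rightarrow> real"
    and \<epsilon> :: "nat \<Rightarrow> real"
  assumes "matrix_norm N"
    and "diagonalizable M"
    and "\<forall>c. eigenvalue M c \<longrightarrow> cmod c = 1"
    and "(\<lambda>i. N (D i - M)) summable_on {1..}"
    and "\<And>n. \<epsilon> n = (\<Sum>\<^sub>\<infinity>i\<in>{n<..}. N (D i - M))"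
  shows "\<exists>F.
    (\<lambda>n. left_prod D n ** mat_pow (matrix_inv M) n) \<longlonglongrightarrow> F \<and>
    (det F \<noteq> 0 \<longleftrightarrow> (\<forall>i\<ge>1. invertible (D i))) \<and>
    (\<lambda>n. N (F - left_prod D n ** mat_pow (matrix_inv M) n)) \<in> O(\<epsilon>) \<and>
    (\<lambda>n. N (left_prod D n - F ** mat_pow M n)) \<in> O(\<epsilon>) \<and>
    seq_closure (left_prod D) = seq_closure (\<lambda>n. F ** mat_pow M n) \<and>
    (\<forall>h\<ge>1. \<forall>f :: complex^'n^'n \<Rightarrow> 'g::metric_space.
       let dom = closure {F ** mat_pow M n |n. n \<ge> h} \<union> (\<Union>n\<in>{h..}. {left_prod D n})
       in continuous_on dom f \<longrightarrow>
            compact dom \<and>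
            asymp_seq (\<lambda>n. f (left_prod D n)) (\<lambda>n. f (F ** mat_pow M n)) \<and>
            seq_closure (\<lambda>n. f (left_prod D n)) = seq_closure (\<lambda>n. f (F ** mat_pow M n)))"
proof -
  have N0: "0 \<le> N A" for A
    using assms(1) by (simp add: matrix_norm_def)
  have scale: "N (r *\<^sub>R A) = \<bar>r\<bar> * N A" for r A
  proof -
    have "r *\<^sub>R A = (\<chi> i j. complex_of_real r * A $ i $ j)"
      by (simp add: vec_eq_iff scaleR_conv_of_real[where 'a = complex])
    then show ?thesis using assms(1) by (simp add: matrix_norm_def)
  qed
  obtain C c where C: "C > 0" "c > 0" "\<And>A. N A \<le> C * norm A" "\<And>A. norm A \<le> c * N A"
    by (rule norm_equivalence[of N]) (use assms(1) scale in \<open>auto simp: matrix_norm_def\<close>)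
  define V where "V = matrix_inv M"
  obtain K where K: "K > 0" "M ** V = mat 1" "\<And>n. norm (mat_pow M n) \<le> K" "\<And>n. norm (mat_pow V n) \<le> K"
    using diagonalizable_unimodular_powers_bounded[OF assms(2,3)] unfolding V_def by blast
  have VM: "V ** M = mat 1" using K(2) by (simp add: matrix_left_right_inverse)
  define g where "g i = N (D i - M)" for i
  have "g summable_on {1..}" and eps_infsum: "\<epsilon> n = infsum g {n<..}" and "0 \<le> g n" for n
    using assms(4,5) N0 unfolding g_def by simp_all
  note tail = infsum_greaterThan_eq_suminf[of g, OF this(3,1)]
  have sg: "summable (\<lambda>i. g (Suc i))" by (rule tail(1))
  have eps: "\<epsilon> n = (\<Sum>i. g (Suc (i + n)))" for n
    unfolding eps_infsum by (rule tail(2))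
  have eps0: "0 \<le> \<epsilon> n" for n
    unfolding eps using summable_ignore_initial_segment[OF sg, of n] N0
    by (intro suminf_nonneg) (simp_all add: g_def)
  define E where "E i = mat_pow M (i - 1) ** (D i - M) ** mat_pow V i" for i
  define Q where "Q = left_prod (\<lambda>i. mat 1 + E i)"
  have Q: "left_prod D n ** mat_pow V n = Q n" for n
    using left_prod_mult_mat_pow_inverse[OF K(2)] by (simp add: Q_def E_def)
  have normE: "norm (E (Suc i)) \<le> K * c * K * g (Suc i)" for i
  proof -
    have "norm (E (Suc i)) \<le> norm (mat_pow M i) * norm (D (Suc i) - M) * norm (mat_pow V (Suc i))"
      unfolding E_def diff_Suc_1
      by (intro order_trans[OF norm_matrix_mult_le] mult_right_mono norm_matrix_mult_le norm_ge_zero)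
    also have "\<dots> \<le> K * (c * g (Suc i)) * K"
      unfolding g_def using K C N0 by (intro mult_mono mult_nonneg_nonneg) (auto simp: less_imp_le simp del: mat_pow.simps)
    finally show ?thesis by (simp only: mult_ac)
  qed
  have sE: "summable (\<lambda>i. norm (E (Suc i)))"
    by (rule summable_comparison_test'[OF summable_mult[OF sg, of "K * c * K"]]) (use normE in auto)
  have tailE: "(\<Sum>i. norm (E (Suc (i + n)))) \<le> K * c * K * \<epsilon> n" for n
  proof -
    have s: "summable (\<lambda>i. g (Suc (i + n)))" "summable (\<lambda>i. norm (E (Suc (i + n))))"
      using summable_ignore_initial_segment[OF sg, of n] summable_ignore_initial_segment[OF sE, of n]
      by simp_all
    show ?thesis
      unfolding eps suminf_mult[OF s(1), symmetric]
      by (intro suminf_le normE s summable_mult)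
  qed
  define B where "B = norm (mat 1 :: complex^'n^'n) * exp (\<Sum>i. norm (E (Suc i)))"
  have B: "B \<ge> 0" by (simp add: B_def)
  obtain F where F: "Q \<longlonglongrightarrow> F"
    and FQ: "\<And>n. norm (F - Q n) \<le> B * (\<Sum>i. norm (E (Suc (i + n))))"
    by (rule left_prod_near_1_converges[OF sE order_refl, folded Q_def B_def]) (rule that)
  define L where "L = B * (K * c * K)"
  have FQe: "norm (F - Q n) \<le> L * \<epsilon> n" for n
    using order_trans[OF FQ mult_left_mono[OF tailE B]] by (simp add: L_def mult.assoc)
  have diff: "left_prod D n - F ** mat_pow M n = - ((F - Q n) ** mat_pow M n)" for n
  proof -
    have "Q n ** mat_pow M n = left_prod D n ** (mat_pow V n ** mat_pow M n)"
      by (simp only: Q[symmetric] matrix_mul_assoc)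
    then show ?thesis by (simp add: mat_pow_mult_inverse[OF VM] matrix_mult.diff_left)
  qed
  have PF: "norm (left_prod D n - F ** mat_pow M n) \<le> norm (F - Q n) * K" for n
    unfolding diff norm_minus_cancel
    by (rule order_trans[OF norm_matrix_mult_le mult_left_mono[OF K(3)]]) simp
  have asymp: "asymp_seq (left_prod D) (\<lambda>n. F ** mat_pow M n)"
  proof -
    have "(\<lambda>n. norm (F - Q n) * K) \<longlonglongrightarrow> norm (F - F) * K"
      by (intro tendsto_intros F)
    then have lim: "(\<lambda>n. norm (F - Q n) * K) \<longlonglongrightarrow> 0" by simp
    show ?thesis
      unfolding asymp_seq_def dist_norm
    proof (rule Lim_null_comparison[OF always_eventually lim], rule allI)
      show "norm (norm (left_prod D n - F ** mat_pow M n)) \<le> norm (F - Q n) * K" for n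
        using PF[of n] by simp
    qed
  qed
  have det: "det F \<noteq> 0 \<longleftrightarrow> (\<forall>i\<ge>1. invertible (D i))"
  proof -
    have "det (mat_pow M n) \<noteq> 0" "det (mat_pow V n) \<noteq> 0" for n
      using mat_pow_mult_inverse[OF K(2), of n, THEN arg_cong[where f = det]] by (auto simp: det_mul)
    then have "det (mat 1 + E i) \<noteq> 0 \<longleftrightarrow> invertible (D i)" if "i \<ge> 1" for i
      using conjugated_factor_eq[OF K(2), of "i - 1" "D i"] that
      by (simp add: E_def det_mul invertible_det_nz del: mat_pow.simps)
    then show ?thesis
      using det_left_prod_limit_nonzero_iff[OF sE F[unfolded Q_def]] by blast
  qed
  have bigo: "(\<lambda>n. N (X n)) \<in> O(\<epsilon>)" if X: "\<And>n. norm (X n) \<le> R * \<epsilon> n" for X R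
  proof (intro bigoI[of _ "C * R"] always_eventually allI)
    fix n
    have "N (X n) \<le> C * (R * \<epsilon> n)"
      by (rule order_trans[OF C(3) mult_left_mono[OF X less_imp_le[OF C(1)]]])
    then show "norm (N (X n)) \<le> C * R * norm (\<epsilon> n)"
      by (simp only: real_norm_def abs_of_nonneg[OF N0] abs_of_nonneg[OF eps0] mult.assoc)
  qed
  have O1: "(\<lambda>n. N (F - Q n)) \<in> O(\<epsilon>)"
    by (rule bigo) (rule FQe)
  have "norm (left_prod D n - F ** mat_pow M n) \<le> L * K * \<epsilon> n" for n
    using order_trans[OF PF mult_right_mono[OF FQe less_imp_le[OF K(1)]], of n]
    by (simp only: mult_ac)
  then have O2: "(\<lambda>n. N (left_prod D n - F ** mat_pow M n)) \<in> O(\<epsilon>)"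
    by (rule bigo)
  have bounded: "bounded {F ** mat_pow M n |n. n \<ge> h}" for h
  proof (rule boundedI)
    fix X assume "X \<in> {F ** mat_pow M n |n. n \<ge> h}"
    then obtain n where "X = F ** mat_pow M n" by blast
    then show "norm X \<le> norm F * K"
      using order_trans[OF norm_matrix_mult_le mult_left_mono[OF K(3) norm_ge_zero]] by simp
  qed
  define dom where "dom h = closure {F ** mat_pow M n |n. n \<ge> h} \<union> (\<Union>n\<in>{h..}. {left_prod D n})"
    for h
  have in_dom: "left_prod D n \<in> dom h" "F ** mat_pow M n \<in> closure {F ** mat_pow M n |n. n \<ge> h}"
    if "n \<ge> h" for n h
  proof -
    show "left_prod D n \<in> dom h" using that by (auto simp: dom_def)
    have "F ** mat_pow M n \<in> {F ** mat_pow M n |n. n \<ge> h}" using that by blast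
    then show "F ** mat_pow M n \<in> closure {F ** mat_pow M n |n. n \<ge> h}"
      by (rule closure_subset[THEN subsetD])
  qed
  have comp: "compact (dom h)" for h
    unfolding dom_def using bounded in_dom(2) asymp
    by (intro compact_Un_asymptotic_seq) (simp_all only: compact_closure)
  have fasymp: "asymp_seq (\<lambda>n. f (left_prod D n)) (\<lambda>n. f (F ** mat_pow M n))"
    if "continuous_on (dom h) f" for h and f :: "complex^'n^'n \<Rightarrow> 'g"
  proof (rule asymp_seq_continuous_image[OF comp that _ _ asymp])
    show "F ** mat_pow M n \<in> dom h" if "n \<ge> h" for n
      using in_dom(2)[OF that] by (simp add: dom_def)
  qed (rule in_dom(1))
  have ii: "\<forall>h\<ge>1. \<forall>f :: complex^'n^'n \<Rightarrow> 'g.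
       let dom = closure {F ** mat_pow M n |n. n \<ge> h} \<union> (\<Union>n\<in>{h..}. {left_prod D n})
       in continuous_on dom f \<longrightarrow>
            compact dom \<and>
            asymp_seq (\<lambda>n. f (left_prod D n)) (\<lambda>n. f (F ** mat_pow M n)) \<and>
            seq_closure (\<lambda>n. f (left_prod D n)) = seq_closure (\<lambda>n. f (F ** mat_pow M n))"
    unfolding Let_def dom_def[symmetric]
    using comp fasymp asymp_seq_imp_seq_closure_eq[OF fasymp] by blast
  show ?thesis
    unfolding V_def[symmetric] Q
    using F det O1 O2 asymp_seq_imp_seq_closure_eq[OF asymp] ii
    by (intro exI[of _ F] conjI)
qed

end
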